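(* Let $G$ be a finite group. Then \[E(\mathrm{EPow}(G))\subseteq E(\mathrm{DCom}(G))\subseteq E(\mathrm{Com}(G)),\] where $E(\Gamma)$ denotes the edge set of a graph $\Gamma$, and $\mathrm{EPow}(G)$, $\mathrm{DCom}(G)$ and $\mathrm{Com}(G)$ are respectively the enhanced power graph, the deep commuting graph and the commuting graph of $G$.
   Context: All three graphs have vertex set $G$. In the commuting graph $\mathrm{Com}(G)$, distinct $x,y$ are joined if $xy=yx$. In the enhanced power graph $\mathrm{EPow}(G)$, distinct $x,y$ are joined if $\langle x,y\rangle$ is cyclic. A central extension of a finite group $G$ is a finite group $H$ together with a surjective homomorphism $\pi\colon H\to G$ whose kernel $Z$ satisfies $Z\leqslant Z(H)$. It is a stem extension if $Z\leqslant Z(H)\cap H'$, where $H'$ is the derived subgroup. The Schur multiplier of $G$ is $M(G)=(R\cap F')/[R,F]$, where $G\cong F/R$ with $F$ free. A Schur cover of $G$ is a stem extension of $G$ of largest possible order, equivalently a stem extension whose kernel is isomorphic to $M(G)$. In the deep commuting graph $\mathrm{DCom}(G)$, distinct $x,y\in G$ are joined if and only if their inverse images in a Schur cover $\pi\colon H\to G$ commute, i.e. $ab=ba$ for some (equivalently, since $\ker\pi$ is central, for all) $a\in\pi^{-1}(x)$, $b\in\pi^{-1}(y)$. This edge set is independent of the choice of Schur cover. *)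

theory Defs
  imports "HOL-Algebra.Algebra"
begin

record 'a simple_graph =
  verts :: "'a set"
  edges :: "'a set set"

definition graph_on :: "'a set \<Rightarrow> ('a \<Rightarrow> 'a \<Rightarrow> bool) \<Rightarrow> 'a simple_graph" where
  "graph_on V adj =
     \<lparr> verts = V, edges = {{x, y} | x y. x \<in> V \<and> y \<in> V \<and> x \<noteq> y \<and> adj x y} \<rparr>"

definition center :: "('a, 'm) monoid_scheme \<Rightarrow> 'a set" where
  "center G = {z \<in> carrier G. \<forall>g \<in> carrier G. z \<otimes>\<^bsub>G\<^esub> g = g \<otimes>\<^bsub>G\<^esub> z}"

definition commuting_graph :: "('a, 'm) monoid_scheme \<Rightarrow> 'a simple_graph" where
  "commuting_graph G = graph_on (carrier G) (\<lambda>x y. x \<otimes>\<^bsub>G\<^esub> y = y \<otimes>\<^bsub>G\<^esub> x)"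

definition enhanced_power_graph :: "('a, 'm) monoid_scheme \<Rightarrow> 'a simple_graph" where
  "enhanced_power_graph G =
     graph_on (carrier G) (\<lambda>x y. cyclic_group (subgroup_generated G {x, y}))"

definition central_extension ::
  "('a, 'm) monoid_scheme \<Rightarrow> ('h, 'n) monoid_scheme \<Rightarrow> ('h \<Rightarrow> 'a) \<Rightarrow> bool" where
  "central_extension G H \<pi> \<longleftrightarrow>
     group H \<and> finite (carrier H) \<and> \<pi> \<in> hom H G \<and> \<pi> ` carrier H = carrier G \<and>
     kernel H G \<pi> \<subseteq> center H"

definition stem_extension ::
  "('a, 'm) monoid_scheme \<Rightarrow> ('h, 'n) monoid_scheme \<Rightarrow> ('h \<Rightarrow> 'a) \<Rightarrow> bool" where
  "stem_extension G H \<pi> \<longleftrightarrow>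
     central_extension G H \<pi> \<and> kernel H G \<pi> \<subseteq> center H \<inter> derived H (carrier H)"

text \<open>
  A formula cannot quantify over types, so the competing stem extensions \<open>K\<close> in the
  maximality condition have their elements in \<^typ>\<open>nat\<close>. This is no restriction: every finite
  group is isomorphic to one with carrier in \<^typ>\<open>nat\<close>.
\<close>

definition schur_cover ::
  "('a, 'm) monoid_scheme \<Rightarrow> ('h, 'n) monoid_scheme \<Rightarrow> ('h \<Rightarrow> 'a) \<Rightarrow> bool" where
  "schur_cover G H \<pi> \<longleftrightarrow>
     stem_extension G H \<pi> \<and>
     (\<forall>(K :: nat monoid) \<sigma>. stem_extension G K \<sigma> \<longrightarrow> order K \<le> order H)"

definition deep_commuting_graph_of ::
  "('a, 'm) monoid_scheme \<Rightarrow> ('h, 'n) monoid_scheme \<Rightarrow> ('h \<Rightarrow> 'a) \<Rightarrow> 'a simple_graph" where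
  "deep_commuting_graph_of G H \<pi> =
     graph_on (carrier G)
       (\<lambda>x y. \<exists>a \<in> carrier H. \<exists>b \<in> carrier H.
                \<pi> a = x \<and> \<pi> b = y \<and> a \<otimes>\<^bsub>H\<^esub> b = b \<otimes>\<^bsub>H\<^esub> a)"

text \<open>
  The deep commuting graph does not depend on the Schur cover, so it is defined through an
  arbitrarily chosen one. Every finite group has a Schur cover with elements in \<^typ>\<open>nat\<close>.
\<close>

definition deep_commuting_graph :: "('a, 'm) monoid_scheme \<Rightarrow> 'a simple_graph" where
  "deep_commuting_graph G =
     (let (H, \<pi>) = (SOME (H :: nat monoid, \<pi>). schur_cover G H \<pi>)
      in deep_commuting_graph_of G H \<pi>)"

end

theory Submission
  imports Defs
begin

text \<open>
  Both inclusions are elementary once the edges of the deep commuting graph are known to come from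
  an actual Schur cover \<open>\<pi> : H \<rightarrow> G\<close>. If \<open>\<langle>x, y\<rangle>\<close> is generated by \<open>g\<close>, then \<open>x\<close> and \<open>y\<close> lift to powers of
  one preimage of \<open>g\<close>, and these commute; and \<open>\<pi>\<close> maps commuting elements to commuting elements.

  The substance is the existence of a Schur cover. The deep commuting graph is defined through a
  choice operator, so nothing about it can be derived until a stem extension of largest order is
  shown to exist. Stem extensions exist, the identity of \<open>G\<close> being one, so it suffices to bound their
  orders in terms of \<open>n = |G|\<close>; this is \<open>stem_extension_order_le\<close>.

  Let \<open>\<pi> : H \<rightarrow> G\<close> be a central extension with kernel \<open>Z\<close>. A normalised section \<open>s\<close> of \<open>\<pi>\<close> has a factor
  set \<open>f(x, y) = s(x) s(y) s(xy)\<inverse>\<close> with values in \<open>Z\<close>, and each \<open>h\<close> is \<open>c(h) s(\<pi> h)\<close> with \<open>c(h)\<close> in \<open>Z\<close>,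
  where \<open>c(hk) = c(h) c(k) f(\<pi> h, \<pi> k)\<close>. Two homomorphisms from \<open>H\<close> to abelian groups, each of which
  therefore kills \<open>H'\<close>, give all that is needed about \<open>Z \<inter> H'\<close>.

  \<^item> Modulo the subgroup \<open>L\<close> generated by the values of \<open>f\<close>, the map \<open>c\<close> is a homomorphism that
    restricts to the projection \<open>Z \<rightarrow> Z/L\<close>. Hence \<open>Z \<inter> H' \<subseteq> L\<close> (\<open>derived_kernel_generated\<close>).

  \<^item> Multiplying the cocycle identity over its last argument gives
    \<open>f(x, y)^n F(xy) = F(x) F(y)\<close> with \<open>F(x) = \<Prod>z. f(x, z)\<close>. Hence \<open>h \<mapsto> F(\<pi> h) c(h)^n\<close> is a homomorphism
    that restricts to the \<open>n\<close>-th power map on \<open>Z\<close>, and so \<open>Z \<inter> H'\<close> has exponent dividing \<open>n\<close>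
    (\<open>derived_kernel_exponent\<close>).

  In a stem extension \<open>Z \<subseteq> H'\<close>, so \<open>Z = L\<close> is an abelian group of exponent dividing \<open>n\<close> with at most
  \<open>n\<^sup>2\<close> generators. Therefore \<open>|Z| \<le> n^(n\<^sup>2)\<close>, and \<open>|H| = n |Z|\<close> is bounded.
\<close>

section \<open>Abelian groups and derived subgroups\<close>

lemma (in group_hom) derived_trivial_image:
  assumes "comm_group H" and "z \<in> derived G (carrier G)"
  shows "h z = \<one>\<^bsub>H\<^esub>"
proof -
  have "h ` derived G (carrier G) = derived H (h ` carrier G)"
    using derived_img[of "carrier G"] by simp
  also have "\<dots> = {\<one>\<^bsub>H\<^esub>}"
    by (rule comm_group.derived_eq_singleton[OF assms(1)]) auto
  finally show ?thesis using assms(2) by blast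
qed

text \<open>
  Adjoining one generator \<open>a\<close> with \<open>a^n = 1\<close> to a subgroup \<open>L\<close> of an abelian group enlarges it at most
  \<open>n\<close> times, because the products \<open>a^i b\<close> with \<open>i < n\<close> and \<open>b\<close> in \<open>L\<close> already form a subgroup.
\<close>

lemma (in comm_group) generate_bounded_exponent:
  fixes n :: nat
  assumes "finite A" and "A \<subseteq> carrier G" and "n > 0" and "\<And>a. a \<in> A \<Longrightarrow> a [^] n = \<one>"
  shows "finite (generate G A) \<and> card (generate G A) \<le> n ^ card A"
  using assms(1,2,4)
proof (induction A)
  case empty
  show ?case by (simp add: generate_empty)
next
  case (insert a A)
  let ?L = "generate G A"
  let ?P = "(\<lambda>(i, b). a [^] i \<otimes> b) ` ({..<n} \<times> ?L)"
  have a: "a \<in> carrier G" "a [^] n = \<one>" and A: "A \<subseteq> carrier G" using insert.prems by auto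
  have L: "subgroup ?L G" by (rule generate_is_subgroup[OF A])
  have Lc: "\<And>b. b \<in> ?L \<Longrightarrow> b \<in> carrier G" using subgroup.mem_carrier[OF L] .
  have IH: "finite ?L" "card ?L \<le> n ^ card A" using insert by auto
  have P: "a [^] (i::nat) \<otimes> b \<in> ?P" if "b \<in> ?L" for i b
  proof -
    have "a [^] i = (a [^] n) [^] (i div n) \<otimes> a [^] (i mod n)"
      using a(1) by (simp add: nat_pow_pow nat_pow_mult)
    also have "\<dots> = a [^] (i mod n)" using a by simp
    finally show ?thesis using that assms(3) by force
  qed
  have Pc: "?P \<subseteq> carrier G" using a Lc by auto
  have one: "\<one> \<in> ?P" using P[of \<one> 0] subgroup.one_closed[OF L] by simp
  have mult: "p \<otimes> q \<in> ?P" if p: "p \<in> ?P" and q: "q \<in> ?P" for p q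
  proof -
    obtain i b j d where pq: "p = a [^] (i::nat) \<otimes> b" "q = a [^] (j::nat) \<otimes> d" "b \<in> ?L" "d \<in> ?L"
      using p q by auto
    have "p \<otimes> q = a [^] (i + j) \<otimes> (b \<otimes> d)"
      using pq a(1) Lc by (simp add: nat_pow_mult[symmetric] m_ac)
    then show ?thesis using P subgroup.m_closed[OF L] pq by simp
  qed
  \<comment> \<open>For \<open>n = 1\<close> the exponent is 0, which is right because then \<open>a = 1\<close>.\<close>
  have inva: "inv a = a [^] (n - 1)"
  proof (rule inv_equality)
    show "a [^] (n - 1) \<otimes> a = \<one>"
      using a assms(3) by (metis Suc_diff_1 nat_pow_Suc)
  qed (use a in auto)
  have "generate G (insert a A) \<subseteq> ?P"
  proof
    fix g assume "g \<in> generate G (insert a A)"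
    then show "g \<in> ?P"
    proof (induction rule: generate.induct)
      case one
      show ?case by (rule \<open>\<one> \<in> ?P\<close>)
    next
      case (incl h)
      show ?case
      proof (cases "h = a")
        case True
        then show ?thesis using P[of \<one> 1] subgroup.one_closed[OF L] a by simp
      next
        case False
        then have "h \<in> ?L" using incl by (auto intro: generate.incl)
        then show ?thesis using P[of h 0] Lc by simp
      qed
    next
      case (inv h)
      show ?case
      proof (cases "h = a")
        case True
        then show ?thesis using P[of \<one> "n - 1"] subgroup.one_closed[OF L] a inva by simp
      next
        case False
        then have "inv h \<in> ?L" using inv by (auto intro: generate.inv)
        then show ?thesis using P[of "inv h" 0] Lc by simp
      qed
    next
      case (eng h1 h2)
      then show ?case using mult by blast
    qed
  qed
  moreover have fin: "finite ?P" using IH by simp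
  moreover have "card ?P \<le> n * n ^ card A"
  proof -
    have "card ?P \<le> card ({..<n} \<times> ?L)" using IH by (intro card_image_le) simp
    also have "\<dots> = n * card ?L" by (simp add: card_cartesian_product)
    also have "\<dots> \<le> n * n ^ card A" using IH by simp
    finally show ?thesis .
  qed
  ultimately have "card (generate G (insert a A)) \<le> n * n ^ card A"
    using card_mono order.trans by blast
  moreover have "finite (generate G (insert a A))"
    using \<open>generate G (insert a A) \<subseteq> ?P\<close> fin by (rule finite_subset)
  ultimately show ?case using insert.hyps by simp
qed


section \<open>Central extensions with a chosen section\<close>

text \<open>
  The normalisation \<open>s 1 = 1\<close> makes the decomposition of a kernel element \<open>z\<close> read \<open>z = z \<cdot> s 1\<close>, so that
  the homomorphisms built below restrict to the projection and to the power map on the kernel, without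
  correction factors.
\<close>

locale sectioned_central_extension =
  fixes G :: "('a, 'm) monoid_scheme" and H :: "('h, 'n) monoid_scheme"
    and \<pi> :: "'h \<Rightarrow> 'a" and s :: "'a \<Rightarrow> 'h"
  assumes G: "group G" and finG: "finite (carrier G)"
    and ext: "central_extension G H \<pi>"
    and s_closed [simp, intro]: "x \<in> carrier G \<Longrightarrow> s x \<in> carrier H"
    and \<pi>_s [simp]: "x \<in> carrier G \<Longrightarrow> \<pi> (s x) = x"
    and s_one [simp]: "s \<one>\<^bsub>G\<^esub> = \<one>\<^bsub>H\<^esub>"

sublocale sectioned_central_extension \<subseteq> group_hom H G \<pi>
  using G ext by (simp add: central_extension_def group_hom_def group_hom_axioms_def)

context sectioned_central_extension
begin

text \<open>
  The kernel is treated as an abelian group in its own right, so that products over \<open>G\<close> and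
  quotients can be formed in it.
\<close>

definition Z where "Z = H\<lparr>carrier := kernel H G \<pi>\<rparr>"

text \<open>
  The kernel component \<open>c(h)\<close> in the decomposition \<open>h = c(h) s(\<pi> h)\<close>.
\<close>

definition defect where "defect h = h \<otimes>\<^bsub>H\<^esub> inv\<^bsub>H\<^esub> s (\<pi> h)"

text \<open>
  This is \<open>s(x) s(y) s(xy)\<inverse>\<close>, the factor set of Schreier's theory of group extensions.
\<close>

definition factor_set where "factor_set x y = defect (s x \<otimes>\<^bsub>H\<^esub> s y)"

lemma Z_simps [simp]: "carrier Z = kernel H G \<pi>" "(\<otimes>\<^bsub>Z\<^esub>) = (\<otimes>\<^bsub>H\<^esub>)" "\<one>\<^bsub>Z\<^esub> = \<one>\<^bsub>H\<^esub>"
  by (simp_all add: Z_def)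

lemma kernel_central:
  assumes "z \<in> kernel H G \<pi>" "h \<in> carrier H"
  shows "z \<otimes>\<^bsub>H\<^esub> h = h \<otimes>\<^bsub>H\<^esub> z"
  using ext assms by (auto simp: central_extension_def center_def)

lemma comm_group_Z: "comm_group Z"
proof (rule group.group_comm_groupI)
  show "group Z"
    unfolding Z_def by (rule subgroup.subgroup_is_group[OF subgroup_kernel]) simp
qed (auto simp: kernel_central kernel_def)

end

sublocale sectioned_central_extension \<subseteq> Z: comm_group Z
  by (rule comm_group_Z)

context sectioned_central_extension
begin

lemma defect_closed [simp, intro]: "h \<in> carrier H \<Longrightarrow> defect h \<in> carrier Z"
  by (simp add: defect_def kernel_def)

lemma defect_kernel: "z \<in> kernel H G \<pi> \<Longrightarrow> defect z = z"
  by (simp add: defect_def kernel_def)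

lemma defect_section: "x \<in> carrier G \<Longrightarrow> defect (s x) = \<one>\<^bsub>Z\<^esub>"
  by (simp add: defect_def)

lemma factor_set_closed [simp, intro]:
  "x \<in> carrier G \<Longrightarrow> y \<in> carrier G \<Longrightarrow> factor_set x y \<in> carrier Z"
  unfolding factor_set_def by (intro defect_closed) simp

lemma factor_set_one: "x \<in> carrier G \<Longrightarrow> factor_set \<one>\<^bsub>G\<^esub> x = \<one>\<^bsub>Z\<^esub>"
  by (simp add: factor_set_def defect_def)

text \<open>
  Centrality lets both kernel components be collected on the left, so \<open>c\<close> fails to be a homomorphism
  only by the factor set. The cocycle identity and both homomorphisms below rest on this equation.
\<close>

lemma defect_mult:
  assumes h: "h \<in> carrier H" and k: "k \<in> carrier H"
  shows "defect (h \<otimes>\<^bsub>H\<^esub> k) = defect h \<otimes>\<^bsub>Z\<^esub> defect k \<otimes>\<^bsub>Z\<^esub> factor_set (\<pi> h) (\<pi> k)"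
proof -
  define x y t u where defs: "x = \<pi> h" "y = \<pi> k" "t = defect h" "u = defect k"
  have xy: "x \<in> carrier G" "y \<in> carrier G" using h k by (simp_all add: defs)
  have tu: "t \<in> carrier H" "u \<in> carrier H" "u \<in> kernel H G \<pi>"
    using h k defect_closed by (auto simp: defs kernel_def)
  have h_eq: "h = t \<otimes>\<^bsub>H\<^esub> s x" and k_eq: "k = u \<otimes>\<^bsub>H\<^esub> s y"
    using h k by (simp_all add: defs defect_def G.m_assoc)
  have "h \<otimes>\<^bsub>H\<^esub> k = t \<otimes>\<^bsub>H\<^esub> (s x \<otimes>\<^bsub>H\<^esub> u) \<otimes>\<^bsub>H\<^esub> s y"
    using tu xy by (simp add: h_eq k_eq G.m_assoc)
  also have "\<dots> = t \<otimes>\<^bsub>H\<^esub> u \<otimes>\<^bsub>H\<^esub> (s x \<otimes>\<^bsub>H\<^esub> s y)"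
    unfolding kernel_central[OF tu(3) s_closed[OF xy(1)], symmetric]
    using tu xy by (simp add: G.m_assoc)
  finally have "defect (h \<otimes>\<^bsub>H\<^esub> k) = t \<otimes>\<^bsub>H\<^esub> u \<otimes>\<^bsub>H\<^esub> (s x \<otimes>\<^bsub>H\<^esub> s y) \<otimes>\<^bsub>H\<^esub> inv\<^bsub>H\<^esub> s (x \<otimes>\<^bsub>G\<^esub> y)"
    using h k by (simp add: defect_def defs)
  also have "\<dots> = t \<otimes>\<^bsub>H\<^esub> u \<otimes>\<^bsub>H\<^esub> factor_set x y"
    using tu xy by (simp add: factor_set_def defect_def G.m_assoc)
  finally show ?thesis by (simp add: defs)
qed

text \<open>
  Both sides are the kernel component of the product \<open>s(x) s(y) s(z)\<close>, bracketed in the two ways.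
\<close>

lemma factor_set_cocycle:
  assumes "x \<in> carrier G" "y \<in> carrier G" "z \<in> carrier G"
  shows "factor_set x y \<otimes>\<^bsub>Z\<^esub> factor_set (x \<otimes>\<^bsub>G\<^esub> y) z
       = factor_set y z \<otimes>\<^bsub>Z\<^esub> factor_set x (y \<otimes>\<^bsub>G\<^esub> z)"
proof -
  have fc: "factor_set a b \<in> carrier H" if "a \<in> carrier G" "b \<in> carrier G" for a b
    using factor_set_closed[OF that] by (simp add: kernel_def)
  have "defect (s x \<otimes>\<^bsub>H\<^esub> s y \<otimes>\<^bsub>H\<^esub> s z) = defect (s x \<otimes>\<^bsub>H\<^esub> (s y \<otimes>\<^bsub>H\<^esub> s z))"
    using assms by (simp add: G.m_assoc)
  then show ?thesis
    using assms defect_mult[of "s x \<otimes>\<^bsub>H\<^esub> s y" "s z"] defect_mult[of "s x" "s y \<otimes>\<^bsub>H\<^esub> s z"]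
    by (simp add: defect_section fc flip: factor_set_def)
qed

definition factor_prod where
  "factor_prod x = finprod Z (factor_set x) (carrier G)"

lemma factor_prod_closed [simp, intro]: "x \<in> carrier G \<Longrightarrow> factor_prod x \<in> carrier Z"
  unfolding factor_prod_def by (intro Z.finprod_closed) (auto simp del: Z_simps)

text \<open>
  The \<open>n\<close>-th power of the factor set is a coboundary, with \<open>n\<close> the order of \<open>G\<close>. This follows from the
  product of the cocycle identity over its third argument \<open>z\<close>: the factors \<open>f(x, yz)\<close> run through all
  \<open>f(x, z)\<close>, and \<open>f(x, y)\<close> occurs \<open>n\<close> times.
\<close>

lemma factor_prod_mult:
  assumes x: "x \<in> carrier G" and y: "y \<in> carrier G"
  shows "factor_set x y [^]\<^bsub>Z\<^esub> order G \<otimes>\<^bsub>Z\<^esub> factor_prod (x \<otimes>\<^bsub>G\<^esub> y)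
       = factor_prod x \<otimes>\<^bsub>Z\<^esub> factor_prod y"
proof -
  note Z_simps [simp del]
  have "factor_set x y [^]\<^bsub>Z\<^esub> order G \<otimes>\<^bsub>Z\<^esub> factor_prod (x \<otimes>\<^bsub>G\<^esub> y)
      = finprod Z (\<lambda>z. factor_set x y \<otimes>\<^bsub>Z\<^esub> factor_set (x \<otimes>\<^bsub>G\<^esub> y) z) (carrier G)"
    unfolding factor_prod_def order_def using x y
    by (subst Z.finprod_multf) (auto simp: Z.finprod_const)
  also have "\<dots> = finprod Z (\<lambda>z. factor_set y z \<otimes>\<^bsub>Z\<^esub> factor_set x (y \<otimes>\<^bsub>G\<^esub> z)) (carrier G)"
    using x y by (intro Z.finprod_cong') (auto simp: factor_set_cocycle)
  also have "\<dots> = factor_prod y \<otimes>\<^bsub>Z\<^esub> finprod Z (\<lambda>z. factor_set x (y \<otimes>\<^bsub>G\<^esub> z)) (carrier G)"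
    unfolding factor_prod_def using x y by (subst Z.finprod_multf) auto
  also have "finprod Z (\<lambda>z. factor_set x (y \<otimes>\<^bsub>G\<^esub> z)) (carrier G)
      = finprod Z (factor_set x) ((\<lambda>z. y \<otimes>\<^bsub>G\<^esub> z) ` carrier G)"
    using x y by (subst Z.finprod_reindex) (auto simp: inj_on_def)
  also have "(\<lambda>z. y \<otimes>\<^bsub>G\<^esub> z) ` carrier G = carrier G"
    using y by (rule H.surj_const_mult)
  finally show ?thesis
    using x y by (simp add: factor_prod_def[symmetric] Z.m_comm)
qed

text \<open>
  Since \<open>f^n\<close> is the coboundary of \<open>F\<close>, the \<open>n\<close>-th power map of the kernel extends to a homomorphism
  from \<open>H\<close> to the kernel, which has to vanish on commutators.
\<close>

lemma derived_kernel_exponent: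
  assumes z: "z \<in> carrier Z" and der: "z \<in> derived H (carrier H)"
  shows "z [^]\<^bsub>Z\<^esub> order G = \<one>\<^bsub>Z\<^esub>"
proof -
  define \<phi> where "\<phi> h = factor_prod (\<pi> h) \<otimes>\<^bsub>Z\<^esub> defect h [^]\<^bsub>Z\<^esub> order G" for h
  have "\<phi> \<in> hom H Z"
  proof (rule homI)
    fix h assume "h \<in> carrier H"
    then show "\<phi> h \<in> carrier Z" unfolding \<phi>_def by (simp del: Z_simps)
  next
    note Z_simps [simp del]
    fix h k assume hk: "h \<in> carrier H" "k \<in> carrier H"
    then have "\<phi> (h \<otimes>\<^bsub>H\<^esub> k) = (factor_set (\<pi> h) (\<pi> k) [^]\<^bsub>Z\<^esub> order G \<otimes>\<^bsub>Z\<^esub> factor_prod (\<pi> h \<otimes>\<^bsub>G\<^esub> \<pi> k))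
       \<otimes>\<^bsub>Z\<^esub> (defect h [^]\<^bsub>Z\<^esub> order G \<otimes>\<^bsub>Z\<^esub> defect k [^]\<^bsub>Z\<^esub> order G)"
      unfolding \<phi>_def by (simp add: defect_mult Z.nat_pow_distrib Z.m_ac)
    also have "\<dots> = \<phi> h \<otimes>\<^bsub>Z\<^esub> \<phi> k"
      unfolding \<phi>_def using hk by (subst factor_prod_mult) (simp_all add: Z.m_ac)
    finally show "\<phi> (h \<otimes>\<^bsub>H\<^esub> k) = \<phi> h \<otimes>\<^bsub>Z\<^esub> \<phi> k" .
  qed
  then interpret \<phi>: group_hom H Z \<phi>
    by (simp add: group_hom_def group_hom_axioms_def)
  have "factor_prod \<one>\<^bsub>G\<^esub> = \<one>\<^bsub>Z\<^esub>"
    unfolding factor_prod_def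
    by (rule Z.finprod_one_eqI) (simp only: factor_set_one)
  then have "\<phi> z = z [^]\<^bsub>Z\<^esub> order G"
    using z Z.nat_pow_closed[OF z, of "order G"] by (simp add: \<phi>_def defect_kernel kernel_def)
  then show ?thesis
    using \<phi>.derived_trivial_image[OF comm_group_Z der] by simp
qed

definition factors where
  "factors = (\<lambda>(x, y). factor_set x y) ` (carrier G \<times> carrier G)"

lemma factors_closed: "factors \<subseteq> carrier Z"
  unfolding factors_def by (auto simp del: Z_simps)

text \<open>
  Modulo the values of the factor set, taking kernel components is a homomorphism that extends the
  projection of the kernel onto its quotient; again it has to vanish on commutators.
\<close>

lemma derived_kernel_generated:
  assumes z: "z \<in> carrier Z" and der: "z \<in> derived H (carrier H)"
  shows "z \<in> generate Z factors"
proof -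
  note Z_simps [simp del]
  let ?L = "generate Z factors"
  have L: "subgroup ?L Z" by (rule Z.generate_is_subgroup[OF factors_closed])
  interpret L: normal ?L Z
    using L by (simp add: Z.normal_iff_subgroup)
  have comm: "comm_group (Z Mod ?L)" by (rule Z.abelian_FactGroup[OF L])
  define \<psi> where "\<psi> h = ?L #>\<^bsub>Z\<^esub> defect h" for h
  have "\<psi> \<in> hom H (Z Mod ?L)"
  proof (rule homI)
    fix h assume "h \<in> carrier H"
    then show "\<psi> h \<in> carrier (Z Mod ?L)"
      unfolding \<psi>_def by (auto simp: FactGroup_def RCOSETS_def)
  next
    fix h k assume hk: "h \<in> carrier H" "k \<in> carrier H"
    let ?f = "factor_set (\<pi> h) (\<pi> k)"
    have f: "?f \<in> ?L" using hk by (auto simp: factors_def intro!: generate.incl)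
    \<comment> \<open>The factor set value lies in the subgroup, so its coset is absorbed.\<close>
    have "\<psi> (h \<otimes>\<^bsub>H\<^esub> k) = ?L #>\<^bsub>Z\<^esub> (?f \<otimes>\<^bsub>Z\<^esub> (defect h \<otimes>\<^bsub>Z\<^esub> defect k))"
      using hk by (simp add: \<psi>_def defect_mult Z.m_ac)
    also have "\<dots> = ?L #>\<^bsub>Z\<^esub> ?f #>\<^bsub>Z\<^esub> (defect h \<otimes>\<^bsub>Z\<^esub> defect k)"
      using hk by (subst Z.coset_mult_assoc) (auto simp: L.subset)
    also have "\<dots> = ?L #>\<^bsub>Z\<^esub> (defect h \<otimes>\<^bsub>Z\<^esub> defect k)"
      using f L by (simp add: Z.coset_join2 L.subset subgroup.mem_carrier)
    finally show "\<psi> (h \<otimes>\<^bsub>H\<^esub> k) = \<psi> h \<otimes>\<^bsub>Z Mod ?L\<^esub> \<psi> k"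
      using hk by (simp add: \<psi>_def FactGroup_def L.rcos_sum)
  qed
  then interpret \<psi>: group_hom H "Z Mod ?L" \<psi>
    using comm by (simp add: group_hom_def group_hom_axioms_def comm_group_def)
  have "?L #>\<^bsub>Z\<^esub> z = ?L"
    using \<psi>.derived_trivial_image[OF comm der] z
    by (simp add: \<psi>_def FactGroup_def Z_simps defect_kernel)
  then show ?thesis using z L by (metis Z.coset_join1 L.subset)
qed

lemma order_le: "order H \<le> order G * card (kernel H G \<pi>)"
proof -
  have "inj_on (\<lambda>h. (\<pi> h, defect h)) (carrier H)"
    by (rule inj_onI) (auto simp: defect_def)
  moreover have "(\<lambda>h. (\<pi> h, defect h)) ` carrier H \<subseteq> carrier G \<times> kernel H G \<pi>"
    using defect_closed by auto
  moreover have "finite (carrier G \<times> kernel H G \<pi>)"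
    using finG ext by (auto simp: central_extension_def kernel_def)
  ultimately have "card (carrier H) \<le> card (carrier G \<times> kernel H G \<pi>)"
    by (rule card_inj_on_le)
  then show ?thesis by (simp add: order_def card_cartesian_product)
qed

lemma stem_order_le:
  assumes stem: "stem_extension G H \<pi>"
  shows "order H \<le> order G * order G ^ (order G * order G)"
proof -
  let ?L = "generate Z factors"
  have der: "carrier Z \<subseteq> derived H (carrier H)"
    using stem by (auto simp: stem_extension_def)
  have n: "order G > 0" using finG by (auto simp: order_def card_gt_0_iff)
  have finF: "finite factors" unfolding factors_def using finG by simp
  have "card factors \<le> card (carrier G \<times> carrier G)"
    unfolding factors_def using finG by (intro card_image_le) simp
  then have cF: "card factors \<le> order G * order G"
    by (simp add: order_def card_cartesian_product)
  have L: "finite ?L" "card ?L \<le> order G ^ card factors"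
    using Z.generate_bounded_exponent[OF finF factors_closed n] factors_closed der
      derived_kernel_exponent by blast+
  have "card (kernel H G \<pi>) \<le> card ?L"
    using derived_kernel_generated der L by (intro card_mono) auto
  also have "\<dots> \<le> order G ^ (order G * order G)"
    using L(2) n power_increasing[OF cF, of "order G"] by linarith
  finally show ?thesis using order_le by (meson mult_le_mono2 order.trans)
qed

end


section \<open>Existence of Schur covers\<close>

lemma central_extension_section:
  assumes "group G" "finite (carrier G)" "central_extension G H \<pi>"
  obtains s where "sectioned_central_extension G H \<pi> s"
proof -
  interpret group_hom H G \<pi>
    using assms by (simp add: central_extension_def group_hom_def group_hom_axioms_def)
  define s where "s x = (if x = \<one>\<^bsub>G\<^esub> then \<one>\<^bsub>H\<^esub> else inv_into (carrier H) \<pi> x)" for x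
  have surj: "\<pi> ` carrier H = carrier G" using assms by (simp add: central_extension_def)
  have "sectioned_central_extension G H \<pi> s"
  proof
    fix x assume "x \<in> carrier G"
    then show "s x \<in> carrier H" "\<pi> (s x) = x"
      using surj by (auto simp: s_def inv_into_into f_inv_into_f)
  qed (use assms in \<open>auto simp: s_def\<close>)
  then show thesis by (rule that)
qed

lemma stem_extension_order_le:
  assumes "group G" "finite (carrier G)" "stem_extension G H \<pi>"
  shows "order H \<le> order G * order G ^ (order G * order G)"
proof -
  obtain s where "sectioned_central_extension G H \<pi> s"
    using central_extension_section assms unfolding stem_extension_def by metis
  then show ?thesis using sectioned_central_extension.stem_order_le assms(3) by blast
qed

text \<open>
  The identity of \<open>G\<close> is a stem extension; the group is transported to the natural numbers because the
  competitors in the definition of a Schur cover live there.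
\<close>

lemma trivial_stem_extension:
  assumes "group G" "finite (carrier G)"
  obtains H :: "nat monoid" and \<pi> where "stem_extension G H \<pi>"
proof -
  interpret group G by fact
  obtain e :: "'a \<Rightarrow> nat" where e: "inj_on e (carrier G)"
    using finite_imp_inj_to_nat_seg[OF assms(2)] by blast
  define p where "p = inv_into (carrier G) e"
  define H where "H = \<lparr>carrier = e ` carrier G, monoid.mult = (\<lambda>i j. e (p i \<otimes>\<^bsub>G\<^esub> p j)), one = e \<one>\<^bsub>G\<^esub>\<rparr>"
  have pe [simp]: "p (e x) = x" if "x \<in> carrier G" for x
    using e that by (simp add: p_def)
  have H: "group H"
  proof (rule groupI)
    fix i assume "i \<in> carrier H"
    then obtain x where "x \<in> carrier G" "i = e x" by (auto simp: H_def)
    then show "\<exists>j \<in> carrier H. j \<otimes>\<^bsub>H\<^esub> i = \<one>\<^bsub>H\<^esub>"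
      by (intro bexI[of _ "e (inv\<^bsub>G\<^esub> x)"]) (auto simp: H_def)
  qed (auto simp: H_def m_assoc)
  have ker: "kernel H G p \<subseteq> {\<one>\<^bsub>H\<^esub>}"
    by (auto simp: kernel_def H_def)
  have "\<one>\<^bsub>H\<^esub> \<in> center H" "\<one>\<^bsub>H\<^esub> \<in> derived H (carrier H)"
    using H by (auto simp: center_def group.is_monoid derived_def generate.one)
  moreover have "p \<in> hom H G" "p ` carrier H = carrier G"
    by (auto simp: hom_def H_def image_image)
  ultimately have "stem_extension G H p"
    using H ker assms(2) by (auto simp: stem_extension_def central_extension_def H_def)
  then show thesis by (rule that)
qed

text \<open>
  Orders of stem extensions are bounded and at least one exists, so one of largest order exists.
\<close>

lemma schur_cover_exists:
  assumes "group G" "finite (carrier G)"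
  obtains H :: "nat monoid" and \<pi> where "schur_cover G H \<pi>"
proof -
  let ?P = "\<lambda>(H :: nat monoid, \<pi>). stem_extension G H \<pi>"
  obtain H0 :: "nat monoid" and \<pi>0 where "stem_extension G H0 \<pi>0"
    using trivial_stem_extension[OF assms] by blast
  then have "?P (H0, \<pi>0)" by simp
  moreover have "\<forall>q. ?P q \<longrightarrow> order (fst q) < Suc (order G * order G ^ (order G * order G))"
    using stem_extension_order_le[OF assms] by (auto simp: less_Suc_eq_le)
  ultimately obtain q where q: "?P q" "\<forall>r. ?P r \<longrightarrow> order (fst r) \<le> order (fst q)"
    using ex_has_greatest_nat[of ?P "(H0, \<pi>0)" "\<lambda>q. order (fst q)"] by blast
  then have "schur_cover G (fst q) (snd q)"
    unfolding schur_cover_def by (cases q) auto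
  then show thesis by (rule that)
qed


section \<open>Edges of the three graphs\<close>

text \<open>
  Existence turns the choice in the definition of the deep commuting graph into a genuine Schur cover.
\<close>

lemma deep_commuting_graph_cover:
  assumes "group G" "finite (carrier G)"
  obtains H :: "nat monoid" and \<pi>
  where "schur_cover G H \<pi>" and "deep_commuting_graph G = deep_commuting_graph_of G H \<pi>"
proof -
  let ?P = "\<lambda>(H :: nat monoid, \<pi>). schur_cover G H \<pi>"
  obtain H0 :: "nat monoid" and \<pi>0 where "schur_cover G H0 \<pi>0"
    using schur_cover_exists[OF assms] by blast
  then have "?P (Eps ?P)" by (intro someI[of ?P "(H0, \<pi>0)"]) simp
  then show thesis
    using that by (auto simp: deep_commuting_graph_def case_prod_beta)
qed

lemma graph_on_edges_mono:
  assumes "\<And>x y. x \<in> V \<Longrightarrow> y \<in> V \<Longrightarrow> adj x y \<Longrightarrow> adj' x y"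
  shows "edges (graph_on V adj) \<subseteq> edges (graph_on V adj')"
  using assms by (auto simp: graph_on_def)

lemma (in group) cyclic_pair_powers:
  assumes xy: "x \<in> carrier G" "y \<in> carrier G" and cyc: "cyclic_group (subgroup_generated G {x, y})"
  obtains g and i j :: int where "g \<in> carrier G" "x = g [^] i" "y = g [^] j"
proof -
  let ?S = "subgroup_generated G {x, y}"
  interpret S: group ?S by simp
  obtain g where g: "g \<in> carrier ?S" "carrier ?S = range (\<lambda>n::int. g [^]\<^bsub>?S\<^esub> n)"
    using cyc S.cyclic_group by blast
  have gG: "g \<in> carrier G" using g(1) carrier_subgroup_generated_subset by blast
  have "x \<in> carrier ?S" "y \<in> carrier ?S"
    using xy by (simp_all add: carrier_subgroup_generated generate.incl)
  then obtain i j :: int where "x = g [^]\<^bsub>?S\<^esub> i" "y = g [^]\<^bsub>?S\<^esub> j"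
    unfolding g(2) by blast
  then show thesis
    using that[OF gG] int_pow_subgroup_generated[OF g(1)] by metis
qed

text \<open>
  Powers of one preimage of a generator are commuting lifts of \<open>x\<close> and \<open>y\<close>.
\<close>

lemma cyclic_pair_lift_commutes:
  assumes ext: "central_extension G H \<pi>" and G: "group G"
    and xy: "x \<in> carrier G" "y \<in> carrier G" and cyc: "cyclic_group (subgroup_generated G {x, y})"
  shows "\<exists>a \<in> carrier H. \<exists>b \<in> carrier H. \<pi> a = x \<and> \<pi> b = y \<and> a \<otimes>\<^bsub>H\<^esub> b = b \<otimes>\<^bsub>H\<^esub> a"
proof -
  interpret group_hom H G \<pi>
    using assms by (simp add: central_extension_def group_hom_def group_hom_axioms_def)
  obtain g and i j :: int where g: "g \<in> carrier G" "x = g [^]\<^bsub>G\<^esub> i" "y = g [^]\<^bsub>G\<^esub> j"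
    using H.cyclic_pair_powers[OF xy cyc] by blast
  obtain c where c: "c \<in> carrier H" "\<pi> c = g"
    using ext g(1) unfolding central_extension_def by (metis imageE)
  have "c [^]\<^bsub>H\<^esub> i \<otimes>\<^bsub>H\<^esub> c [^]\<^bsub>H\<^esub> j = c [^]\<^bsub>H\<^esub> j \<otimes>\<^bsub>H\<^esub> c [^]\<^bsub>H\<^esub> i"
    using c(1) by (simp add: add.commute flip: G.int_pow_mult)
  moreover have "\<pi> (c [^]\<^bsub>H\<^esub> k) = g [^]\<^bsub>G\<^esub> k" for k :: int
    using c by (simp add: hom_int_pow)
  ultimately show ?thesis
    using c(1) g(2,3)
    by (intro bexI[of _ "c [^]\<^bsub>H\<^esub> i"] bexI[of _ "c [^]\<^bsub>H\<^esub> j"]) auto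
qed

theorem theorem4p2:
  fixes G :: "('a, 'm) monoid_scheme"
  assumes "group G" and "finite (carrier G)"
  shows "edges (enhanced_power_graph G) \<subseteq> edges (deep_commuting_graph G) \<and>
         edges (deep_commuting_graph G) \<subseteq> edges (commuting_graph G)"
proof -
  obtain H :: "nat monoid" and \<pi> where cover: "schur_cover G H \<pi>"
    and dcom: "deep_commuting_graph G = deep_commuting_graph_of G H \<pi>"
    using deep_commuting_graph_cover[OF assms] by blast
  have ext: "central_extension G H \<pi>"
    using cover by (simp add: schur_cover_def stem_extension_def)
  have "edges (enhanced_power_graph G) \<subseteq> edges (deep_commuting_graph G)"
    unfolding dcom enhanced_power_graph_def deep_commuting_graph_of_def
    by (rule graph_on_edges_mono) (rule cyclic_pair_lift_commutes[OF ext assms(1)])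
  moreover have "edges (deep_commuting_graph G) \<subseteq> edges (commuting_graph G)"
    unfolding dcom commuting_graph_def deep_commuting_graph_of_def
  proof (rule graph_on_edges_mono)
    fix x y
    assume "\<exists>a \<in> carrier H. \<exists>b \<in> carrier H. \<pi> a = x \<and> \<pi> b = y \<and> a \<otimes>\<^bsub>H\<^esub> b = b \<otimes>\<^bsub>H\<^esub> a"
    then show "x \<otimes>\<^bsub>G\<^esub> y = y \<otimes>\<^bsub>G\<^esub> x"
      using ext unfolding central_extension_def by (metis hom_mult)
  qed
  ultimately show ?thesis ..
qed

end
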